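(* Let $\Gamma$ be a weighted graph with infinite vertex set $V$. Assume $\Gamma$ is connected and satisfies the Sunada-Sy condition. Let $H$ be a Schrödinger operator on $\Gamma$. Assume that for any finite set $F\subset V$ of vertices, there exists a finite set $\Omega\subset V$ which contains $F$ and which admits a one-by-one exhaustion. Then $H$ has no square summable eigenfunction with finite support.
   Context: Graph (Serre): $\Gamma=(V,E,o,t,\iota)$ with vertex set $V$, set $E$ of oriented edges, origin and terminus maps $o,t:E\to V$, and a fixed point free involution $\iota(e)=\overline{e}$ of $E$ with $o(\overline e)=t(e)$, $t(\overline e)=o(e)$. Loops and multiple edges are allowed; local finiteness is not assumed. $E_x=\{e\in E:o(e)=x\}$. $\Gamma$ is connected if any two vertices are joined by a finite edge path; the path-metric $d(x,y)$ is the minimal length of a path from $x$ to $y$. $B(x,r)=\{y\in V:d(x,y)\le r\}$. Weighted graph: strictly positive weights $m_V:V\to\,]0,\infty[$ and $m_E:E\to\,]0,\infty[$ with $m_E(\overline e)=m_E(e)$. $l^2(V,m_V)$ is the Hilbert space of $\varphi:V\to\mathbb{C}$ with $\sum_x|\varphi(x)|^2m_V(x)<\infty$, with product $\langle\varphi,\psi\rangle=\sum_x\varphi(x)\overline{\psi(x)}m_V(x)$. Sunada-Sy condition: $\sup_{x\in V}\frac{1}{m_V(x)}\sum_{e\in E_x}m_E(e)<\infty$. Laplacian: the bounded operator on $l^2(V,m_V)$ given by $\Delta\varphi(x)=\left(\frac{1}{m_V(x)}\sum_{e\in E_x}m_E(e)\right)\varphi(x)-\frac{1}{m_V(x)}\sum_{e\in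 E_x}\varphi(t(e))m_E(e)$. Schrödinger operator: $H=\Delta+q$ with $q:V\to\mathbb{R}$ bounded; it is self-adjoint. An eigenfunction of $H$ is a nonzero $\varphi\in l^2(V,m_V)$ with $H\varphi=\lambda\varphi$ for some $\lambda\in\mathbb{R}$. One-by-one exhaustion of $\Omega\subset V$: a countable (finite or infinite) non-decreasing sequence $V_0\subset\cdots\subset V_n\subset V_{n+1}\subset\cdots$ of subsets of $V$ such that (1) $V_0=V\setminus\Omega$; (2) for each $n$ (for which $V_{n+1}$ is a term of the sequence) there exists $x_n\in V_n$ with $V_{n+1}=V_n\cup B(x_n,1)$; (3) for each such $n$, either $|V_{n+1}\setminus V_n|=1$ or $V_n=V$; (4) $\bigcup_nV_n=V$. *)

theory Defs
  imports
    "HOL-Analysis.Analysis"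
    "HOL-Library.Extended_Nat"
    "Graph_Theory.Bidirected_Digraph"
    "Graph_Theory.Digraph_Component"
    "Graph_Theory.Shortest_Path"
begin

text \<open>
  A \<^locale>\<open>bidirected_digraph\<close> is a graph in the sense of Serre: \<^term>\<open>tail G\<close> and \<^term>\<open>head G\<close>
  are the origin and terminus maps, and \<open>arev\<close> is the fixed point free involution of the set of
  oriented edges, extended by the identity to the elements of the edge type that are not edges of
  \<open>G\<close>. Loops, multiple edges and infinite valencies are allowed.
\<close>

locale weighted_graph = bidirected_digraph G arev
  for G :: "('v, 'e) pre_digraph" and arev :: "'e \<Rightarrow> 'e" +
  fixes mV :: "'v \<Rightarrow> real" and mE :: "'e \<Rightarrow> real"
  assumes mV_pos: "\<And>x. x \<in> verts G \<Longrightarrow> 0 < mV x"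
    and mE_pos: "\<And>e. e \<in> arcs G \<Longrightarrow> 0 < mE e"
    and mE_arev: "\<And>e. e \<in> arcs G \<Longrightarrow> mE (arev e) = mE e"

definition path_dist :: "('v, 'e) pre_digraph \<Rightarrow> 'v \<Rightarrow> 'v \<Rightarrow> ereal" where
  "path_dist G x y = wf_digraph.\<mu> G (\<lambda>_. 1) x y"

definition path_ball :: "('v, 'e) pre_digraph \<Rightarrow> 'v \<Rightarrow> real \<Rightarrow> 'v set" where
  "path_ball G x r = {y \<in> verts G. path_dist G x y \<le> ereal r}"

text \<open>
  The sums are taken in \<^typ>\<open>ennreal\<close>, so that a vertex \<open>x\<close> whose edge weights are not summable
  contributes the value \<open>\<infinity>\<close> to the supremum (over the reals, \<^const>\<open>infsum\<close> would be \<open>0\<close> there).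
\<close>

definition sunada_sy :: "('v, 'e) pre_digraph \<Rightarrow> ('v \<Rightarrow> real) \<Rightarrow> ('e \<Rightarrow> real) \<Rightarrow> bool" where
  "sunada_sy G mV mE \<longleftrightarrow>
     (SUP x\<in>verts G. ennreal (1 / mV x) * (\<Sum>\<^sub>\<infinity>e\<in>out_arcs G x. ennreal (mE e))) < \<infinity>"

text \<open>
  A complex-valued function on the vertex set is represented by its extension by zero to the
  vertex type; this makes pointwise operations and equality of functions the intended ones.
\<close>

definition l2_space :: "('v, 'e) pre_digraph \<Rightarrow> ('v \<Rightarrow> real) \<Rightarrow> ('v \<Rightarrow> complex) set" where
  "l2_space G mV = {\<phi>. (\<forall>x. x \<notin> verts G \<longrightarrow> \<phi> x = 0) \<and>
                       (\<lambda>x. (cmod (\<phi> x))\<^sup>2 * mV x) summable_on verts G}"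

text \<open>
  Under the Sunada-Sy condition, both sums below converge absolutely for every \<open>\<phi>\<close> in
  \<^term>\<open>l2_space G mV\<close> (for the second one, by the Cauchy-Schwarz inequality).
\<close>

definition laplacian ::
    "('v, 'e) pre_digraph \<Rightarrow> ('v \<Rightarrow> real) \<Rightarrow> ('e \<Rightarrow> real) \<Rightarrow> ('v \<Rightarrow> complex) \<Rightarrow> ('v \<Rightarrow> complex)" where
  "laplacian G mV mE \<phi> = (\<lambda>x. if x \<in> verts G then
       complex_of_real (1 / mV x * (\<Sum>\<^sub>\<infinity>e\<in>out_arcs G x. mE e)) * \<phi> x
       - complex_of_real (1 / mV x) * (\<Sum>\<^sub>\<infinity>e\<in>out_arcs G x. \<phi> (head G e) * complex_of_real (mE e))
     else 0)"

definition schroedinger ::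
    "('v, 'e) pre_digraph \<Rightarrow> ('v \<Rightarrow> real) \<Rightarrow> ('e \<Rightarrow> real) \<Rightarrow> ('v \<Rightarrow> real)
      \<Rightarrow> ('v \<Rightarrow> complex) \<Rightarrow> ('v \<Rightarrow> complex)" where
  "schroedinger G mV mE q \<phi> = (\<lambda>x. laplacian G mV mE \<phi> x + complex_of_real (q x) * \<phi> x)"

definition l2_eigenfunction ::
    "('v, 'e) pre_digraph \<Rightarrow> ('v \<Rightarrow> real) \<Rightarrow> (('v \<Rightarrow> complex) \<Rightarrow> ('v \<Rightarrow> complex))
      \<Rightarrow> ('v \<Rightarrow> complex) \<Rightarrow> bool" where
  "l2_eigenfunction G mV H \<phi> \<longleftrightarrow>
     \<phi> \<in> l2_space G mV \<and> \<phi> \<noteq> (\<lambda>_. 0) \<and>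
     (\<exists>lam::real. H \<phi> = (\<lambda>x. complex_of_real lam * \<phi> x))"

text \<open>
  The terms of the sequence are the sets \<open>W n\<close> with \<open>n \<le> N\<close>. Thus \<open>N\<close> is the index of the last term
  of a finite sequence and \<open>N = \<infinity>\<close> for an infinite one; the values \<open>W n\<close> with \<open>n > N\<close> are irrelevant.
\<close>

definition one_by_one_exhaustion ::
    "('v, 'e) pre_digraph \<Rightarrow> 'v set \<Rightarrow> enat \<Rightarrow> (nat \<Rightarrow> 'v set) \<Rightarrow> bool" where
  "one_by_one_exhaustion G \<Omega> N W \<longleftrightarrow>
     (\<forall>n. enat n \<le> N \<longrightarrow> W n \<subseteq> verts G) \<and>
     (\<forall>n. enat (Suc n) \<le> N \<longrightarrow> W n \<subseteq> W (Suc n)) \<and>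
     W 0 = verts G - \<Omega> \<and>
     (\<forall>n. enat (Suc n) \<le> N \<longrightarrow> (\<exists>x\<in>W n. W (Suc n) = W n \<union> path_ball G x 1)) \<and>
     (\<forall>n. enat (Suc n) \<le> N \<longrightarrow> card (W (Suc n) - W n) = 1 \<or> W n = verts G) \<and>
     (\<Union>n\<in>{n. enat n \<le> N}. W n) = verts G"

definition admits_one_by_one_exhaustion :: "('v, 'e) pre_digraph \<Rightarrow> 'v set \<Rightarrow> bool" where
  "admits_one_by_one_exhaustion G \<Omega> \<longleftrightarrow> (\<exists>N W. one_by_one_exhaustion G \<Omega> N W)"

end

theory Submission
  imports Defs
begin

text \<open>
  The eigenvalue equation is a unique continuation principle in disguise. If an eigenfunction
  \<open>\<phi>\<close> vanishes at \<open>x\<close>, the diagonal part of the Laplacian, the potential and the eigenvalue drop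
  out of the equation at \<open>x\<close>, and what remains is a balance condition: the sum of
  \<open>\<phi> (head G e) * mE e\<close> over the edges \<open>e\<close> leaving \<open>x\<close> is zero. If \<open>\<phi>\<close> is also known to vanish
  at all neighbours of \<open>x\<close> except one, \<open>y\<close>, the condition reads
  \<open>\<phi> y * (total weight of the edges from x to y) = 0\<close>. The total weight is finite by the
  Sunada-Sy condition and positive, whence \<open>\<phi> y = 0\<close> (lemma \<open>zero_at_last_neighbour\<close>).

  A one-by-one exhaustion of \<open>\<Omega>\<close> is exactly what is needed to repeat this step: each term adds to
  the previous one the single missing neighbour of one of its points. So an eigenfunction that
  vanishes outside \<open>\<Omega>\<close> vanishes on every term, hence everywhere
  (lemma \<open>zero_of_one_by_one_exhaustion\<close>). A finite support can be enclosed in such an \<open>\<Omega>\<close> by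
  hypothesis.
\<close>

lemma (in wf_digraph) head_in_path_ball_1:
  assumes "e \<in> arcs G"
  shows "head G e \<in> path_ball G (tail G e) 1"
proof -
  have "\<mu> (\<lambda>_. 1) (tail G e) (head G e) \<le> awalk_cost (\<lambda>_. 1) [e]"
    using assms by (intro min_cost_le_walk_cost arc_implies_awalk)
  then show ?thesis
    using assms by (simp add: path_ball_def path_dist_def)
qed

text \<open>
  The distance is an infimum in the extended reals, so that a bound by \<open>1\<close> does not at once produce
  a walk of length at most \<open>1\<close>. It does because the lengths are integers: if all walks had
  length at least \<open>2\<close>, so would the infimum.
\<close>

lemma (in wf_digraph) arc_of_path_ball_1:
  assumes "y \<in> path_ball G x 1" and "x \<noteq> y"
  obtains e where "e \<in> out_arcs G x" and "head G e = y"
proof -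
  have "\<exists>e\<in>out_arcs G x. head G e = y"
  proof (rule ccontr)
    assume no_arc: "\<not> (\<exists>e\<in>out_arcs G x. head G e = y)"
    have "ereal 2 \<le> ereal (awalk_cost (\<lambda>_. 1) p)" if "awalk x p y" for p
    proof (cases p)
      case Nil
      then show ?thesis using that assms(2) by (simp add: awalk_Nil_iff)
    next
      case (Cons e p')
      show ?thesis
      proof (cases p')
        case Nil
        then show ?thesis
          using that Cons no_arc by (auto simp: awalk_Cons_iff awalk_Nil_iff)
      next
        case (Cons e' p'')
        have "0 \<le> awalk_cost (\<lambda>_. 1) p''"
          by (induction p'') simp_all
        then show ?thesis using Cons \<open>p = e # p'\<close> by simp
      qed
    qed
    then have "ereal 2 \<le> \<mu> (\<lambda>_. 1) x y"
      unfolding \<mu>_def by (intro INF_greatest) auto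
    also have "\<dots> \<le> ereal 1"
      using assms(1) by (simp add: path_ball_def path_dist_def)
    finally show False by simp
  qed
  then show ?thesis using that by blast
qed

lemma summable_on_of_infsum_ennreal:
  fixes f :: "'a \<Rightarrow> real"
  assumes nonneg: "\<And>a. a \<in> A \<Longrightarrow> 0 \<le> f a"
    and finite_sum: "(\<Sum>\<^sub>\<infinity>a\<in>A. ennreal (f a)) < \<infinity>"
  shows "f summable_on A"
proof (rule nonneg_bdd_above_summable_on[OF nonneg])
  show "bdd_above (sum f ` {F. F \<subseteq> A \<and> finite F})"
  proof (rule bdd_aboveI2)
    fix F assume F: "F \<in> {F. F \<subseteq> A \<and> finite F}"
    have "ennreal (sum f F) = (\<Sum>a\<in>F. ennreal (f a))"
      using F nonneg by (intro sum_ennreal[symmetric]) auto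
    also have "\<dots> = (\<Sum>\<^sub>\<infinity>a\<in>F. ennreal (f a))"
      using F by simp
    also have "\<dots> \<le> (\<Sum>\<^sub>\<infinity>a\<in>A. ennreal (f a))"
      using F by (intro infsum_mono_neutral) (auto intro: nonneg_summable_on_complete)
    finally have "enn2real (ennreal (sum f F)) \<le> enn2real (\<Sum>\<^sub>\<infinity>a\<in>A. ennreal (f a))"
      using finite_sum by (intro enn2real_mono) auto
    moreover have "0 \<le> sum f F"
      using F nonneg by (auto intro: sum_nonneg)
    ultimately show "sum f F \<le> enn2real (\<Sum>\<^sub>\<infinity>a\<in>A. ennreal (f a))"
      by simp
  qed
qed

context weighted_graph
begin

lemma sunada_sy_summable:
  assumes "sunada_sy G mV mE" and x: "x \<in> verts G"
  shows "mE summable_on out_arcs G x"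
proof (rule summable_on_of_infsum_ennreal)
  show "0 \<le> mE e" if "e \<in> out_arcs G x" for e
    using that mE_pos[of e] by simp
  let ?S = "\<Sum>\<^sub>\<infinity>e\<in>out_arcs G x. ennreal (mE e)"
  have "ennreal (1 / mV x) * ?S
      \<le> (SUP x\<in>verts G. ennreal (1 / mV x) * (\<Sum>\<^sub>\<infinity>e\<in>out_arcs G x. ennreal (mE e)))"
    using x by (intro SUP_upper)
  also have "\<dots> < \<infinity>"
    using assms(1) by (simp add: sunada_sy_def)
  finally have "ennreal (1 / mV x) * ?S < \<infinity>" .
  moreover have "0 < ennreal (1 / mV x)"
    using mV_pos[OF x] by simp
  ultimately show "?S < \<infinity>"
    by (auto simp: ennreal_mult_less_top)
qed

text \<open>
  The unique continuation step. Summability matters because infinitely many edges may lead from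
  \<open>x\<close> to \<open>y\<close>: \<^const>\<open>infsum\<close> of a divergent family is \<open>0\<close> by convention, and the balance condition
  would then say nothing about \<open>\<phi> y\<close>.
\<close>

lemma zero_at_last_neighbour:
  assumes x: "x \<in> verts G"
    and summable: "mE summable_on out_arcs G x"
    and eigen: "schroedinger G mV mE q \<phi> x = lam * \<phi> x"
    and "\<phi> x = 0"
    and others: "\<And>e. e \<in> out_arcs G x \<Longrightarrow> head G e \<noteq> y \<Longrightarrow> \<phi> (head G e) = 0"
    and e: "e \<in> out_arcs G x" "head G e = y"
  shows "\<phi> y = 0"
proof -
  define A where "A = {e \<in> out_arcs G x. head G e = y}"
  have "mV x \<noteq> 0"
    using mV_pos[OF x] by simp
  have "mE summable_on A"
    using summable by (rule summable_on_subset_banach) (auto simp: A_def)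
  then have of_real_sum: "(\<Sum>\<^sub>\<infinity>e\<in>A. complex_of_real (mE e)) = complex_of_real (\<Sum>\<^sub>\<infinity>e\<in>A. mE e)"
    by (intro infsumI has_sum_of_real has_sum_infsum)
  have "0 = (\<Sum>\<^sub>\<infinity>e\<in>out_arcs G x. \<phi> (head G e) * complex_of_real (mE e))"
    using eigen x \<open>\<phi> x = 0\<close> \<open>mV x \<noteq> 0\<close>
    by (simp add: schroedinger_def laplacian_def)
  also have "\<dots> = (\<Sum>\<^sub>\<infinity>e\<in>A. \<phi> y * complex_of_real (mE e))"
    by (intro infsum_cong_neutral) (auto simp: A_def others)
  also have "\<dots> = \<phi> y * complex_of_real (\<Sum>\<^sub>\<infinity>e\<in>A. mE e)"
    by (simp add: infsum_cmult_right' of_real_sum)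
  finally have balance: "\<phi> y * complex_of_real (\<Sum>\<^sub>\<infinity>e\<in>A. mE e) = 0"
    by simp
  have A_pos: "0 < mE e" if "e \<in> A" for e
    using that mE_pos by (simp add: A_def)
  have "e \<in> A"
    using e by (simp add: A_def)
  have "mE e \<le> (\<Sum>\<^sub>\<infinity>e\<in>A. mE e)"
    using finite_sum_le_infsum[of mE A "{e}"] \<open>mE summable_on A\<close> \<open>e \<in> A\<close>
      less_imp_le[OF A_pos] by simp
  with A_pos[OF \<open>e \<in> A\<close>] balance show ?thesis
    by simp
qed

lemma zero_of_one_by_one_exhaustion:
  assumes "sunada_sy G mV mE"
    and eigen: "\<And>x. x \<in> verts G \<Longrightarrow> schroedinger G mV mE q \<phi> x = lam * \<phi> x"
    and exh: "one_by_one_exhaustion G \<Omega> N W"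
    and outside: "\<And>x. x \<in> verts G - \<Omega> \<Longrightarrow> \<phi> x = 0"
    and z: "z \<in> verts G"
  shows "\<phi> z = 0"
proof -
  have in_verts: "W n \<subseteq> verts G" if "enat n \<le> N" for n
    using exh that by (simp add: one_by_one_exhaustion_def)
  have step: "\<exists>x\<in>W n. W (Suc n) = W n \<union> path_ball G x 1" if "enat (Suc n) \<le> N" for n
    using exh that by (simp add: one_by_one_exhaustion_def)
  have one_new: "card (W (Suc n) - W n) = 1 \<or> W n = verts G" if "enat (Suc n) \<le> N" for n
    using exh that by (simp add: one_by_one_exhaustion_def)
  have cover: "(\<Union>n\<in>{n. enat n \<le> N}. W n) = verts G"
    using exh by (simp add: one_by_one_exhaustion_def)
  have zero_on_terms: "\<forall>x\<in>W n. \<phi> x = 0" if "enat n \<le> N" for n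
    using that
  proof (induction n)
    case 0
    then show ?case
      using exh outside by (simp add: one_by_one_exhaustion_def)
  next
    case (Suc n)
    have n: "enat n \<le> N"
      using Suc.prems by (metis Suc_ile_eq less_imp_le)
    have zero: "\<phi> v = 0" if "v \<in> W n" for v
      using Suc.IH[OF n] that by blast
    obtain x where x: "x \<in> W n" and W_Suc: "W (Suc n) = W n \<union> path_ball G x 1"
      using step[OF Suc.prems] by blast
    from one_new[OF Suc.prems] show ?case
    proof
      assume "W n = verts G"
      then show ?thesis using zero in_verts[OF Suc.prems] by blast
    next
      assume "card (W (Suc n) - W n) = 1"
      then obtain y where y: "W (Suc n) - W n = {y}"
        by (auto simp: card_1_singleton_iff)
      then have "y \<in> path_ball G x 1" "x \<noteq> y"
        using W_Suc x by blast+
      then obtain e where e: "e \<in> out_arcs G x" "head G e = y"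
        by (rule arc_of_path_ball_1)
      have "x \<in> verts G"
        using x in_verts[OF n] by blast
      have "\<phi> (head G a) = 0" if a: "a \<in> out_arcs G x" and "head G a \<noteq> y" for a
      proof -
        have "head G a \<in> W (Suc n)"
          using head_in_path_ball_1[of a] a W_Suc by auto
        then show ?thesis
          using y zero \<open>head G a \<noteq> y\<close> by blast
      qed
      then have "\<phi> y = 0"
        using zero_at_last_neighbour[of x q \<phi> lam y e] \<open>x \<in> verts G\<close> e zero[OF x]
          sunada_sy_summable[OF assms(1)] eigen by blast
      moreover have "W (Suc n) \<subseteq> insert y (W n)"
        using y by blast
      ultimately show ?thesis
        using zero by auto
    qed
  qed
  obtain n where "enat n \<le> N" "z \<in> W n"
    using cover z by blast
  then show ?thesis
    using zero_on_terms by blast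
qed

end

theorem corollary3p7:
  fixes G :: "('v, 'e) pre_digraph"
    and arev :: "'e \<Rightarrow> 'e"
    and mV :: "'v \<Rightarrow> real"
    and mE :: "'e \<Rightarrow> real"
    and q :: "'v \<Rightarrow> real"
  assumes "weighted_graph G arev mV mE"
    and "infinite (verts G)"
    and "strongly_connected G"
    and "sunada_sy G mV mE"
    and "bounded (q ` verts G)"
    and "\<And>F. finite F \<Longrightarrow> F \<subseteq> verts G \<Longrightarrow>
           \<exists>\<Omega>. finite \<Omega> \<and> \<Omega> \<subseteq> verts G \<and> F \<subseteq> \<Omega> \<and> admits_one_by_one_exhaustion G \<Omega>"
  shows "\<not> (\<exists>\<phi>. l2_eigenfunction G mV (schroedinger G mV mE q) \<phi> \<and>
                 finite {x \<in> verts G. \<phi> x \<noteq> 0})"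
proof
  assume "\<exists>\<phi>. l2_eigenfunction G mV (schroedinger G mV mE q) \<phi> \<and>
               finite {x \<in> verts G. \<phi> x \<noteq> 0}"
  then obtain \<phi> lam where l2: "\<phi> \<in> l2_space G mV" and nonzero: "\<phi> \<noteq> (\<lambda>_. 0)"
    and eigen: "schroedinger G mV mE q \<phi> = (\<lambda>x. complex_of_real lam * \<phi> x)"
    and fin: "finite {x \<in> verts G. \<phi> x \<noteq> 0}"
    unfolding l2_eigenfunction_def by blast
  obtain \<Omega> N W where supp: "{x \<in> verts G. \<phi> x \<noteq> 0} \<subseteq> \<Omega>"
    and exh: "one_by_one_exhaustion G \<Omega> N W"
    using assms(6)[OF fin] unfolding admits_one_by_one_exhaustion_def by blast
  have "\<phi> z = 0" if "z \<in> verts G" for z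
    using assms(1,4) _ exh _ that
  proof (rule weighted_graph.zero_of_one_by_one_exhaustion)
    show "schroedinger G mV mE q \<phi> x = complex_of_real lam * \<phi> x" for x
      by (simp add: eigen)
    show "\<phi> x = 0" if "x \<in> verts G - \<Omega>" for x
      using supp that by blast
  qed
  moreover have "\<phi> z = 0" if "z \<notin> verts G" for z
    using l2 that by (simp add: l2_space_def)
  ultimately show False
    using nonzero by blast
qed

end
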